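(* Let $G$ be a connected graph of order $n \ge 3$. Then $\mathrm{cdim}(G)=2$ if and only if $G$ is not a path and $G \in \mathcal{F}_r$ for some positive integer $r$. Consequently, if $\mathrm{cdim}(G)=2$, then $G$ is planar.
   Context: All graphs are finite, simple, undirected; membership in $\mathcal{F}_r$ is up to isomorphism. A graph is planar if it can be drawn in the plane without edge crossings. A set $S\subseteq V(G)$ is a resolving set of $G$ if for every pair of distinct vertices $x,y$ of $G$ there is $z\in S$ with $d(x,z)\ne d(y,z)$ ($d$ is the shortest-path distance); it is a connected resolving set if moreover the induced subgraph $G[S]$ is connected. $\mathrm{cdim}(G)$ is the minimum cardinality of a connected resolving set of $G$. For $r\ge 1$, $\mathcal{F}_r$ consists of all graphs $G$ with $uw\in E(G)$ satisfying: (R1) $\{u,w\}\subseteq V(G)\subseteq \{u,w\}\cup\{x_a,y_a,z_a:1\leq a\leq r\}$ (all these symbols denoting distinct vertices); (R2) if $x_1 \in V(G)$, then $x_1u \in E(G)$; (R3) if $z_1 \in V(G)$, then $z_1w \in E(G)$; (R4) if $y_1 \in V(G)$, then $y_1u, y_1w \in E(G)$; (R5) if $x_a \in V(G)$ with $2 \leq a \leq r$, then $x_{a-1} \in V(G)$ and $x_ax_{a-1} \in E(G)$; (R6) if $z_a \in V(G)$ with $2 \leq a \leq r$, then $z_{a-1} \in V(G)$ and $z_az_{a-1} \in E(G)$; (R7) if $y_a \in V(G)$ with $2 \leq a \leq r$, then at least one of the following is true: (i) $x_{a-1}, z_{a-1} \in V(G)$ and $x_{a-1}y_a, z_{a-1}y_a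 \in E(G)$; (ii) $y_{a-1} \in V(G)$ and $y_{a-1}y_a \in E(G)$; (R8) any of the edges $x_ay_a$, $x_az_a$, $y_az_a$ (between vertices present in $G$) may or may not be in $E(G)$, for each $1 \leq a \leq r$; (R9) there are no other edges in $G$, i.e. every edge of $G$ is $uw$ or of one of the types mentioned in (R2)–(R8): $x_1u$, $z_1w$, $y_1u$, $y_1w$, $x_ax_{a-1}$, $z_az_{a-1}$, $x_{a-1}y_a$, $z_{a-1}y_a$, $y_{a-1}y_a$ ($2\le a\le r$), $x_ay_a$, $x_az_a$, $y_az_a$ ($1\le a\le r$). In particular, provided (R7) holds, each individual edge $x_{a-1}y_a$, $z_{a-1}y_a$, $y_{a-1}y_a$ may be present or absent. *)

theory Defs
  imports
    "HOL-Analysis.Analysis"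
    "Graph_Theory.Pair_Digraph"
    "Graph_Theory.Digraph_Component"
    "Graph_Theory.Digraph_Isomorphism"
    "Graph_Theory.Vertex_Walk"
    "Graph_Theory.Shortest_Path"
begin

text \<open>
  Finite simple undirected graphs are instances of \<^locale>\<open>pair_graph\<close>: the arc relation is
  symmetric, and an edge is a pair of opposite arcs. Connectedness, induced subgraphs,
  distances (all arcs having weight 1) and isomorphism are the library ones. The name
  \<^const>\<open>Digraph_Component.connected\<close> is qualified because it coincides with that of a
  topological notion; it excludes the graph without vertices.
\<close>
definition gdist :: "'a pair_pre_digraph \<Rightarrow> 'a \<Rightarrow> 'a \<Rightarrow> ereal" where
  "gdist G x y = wf_digraph.\<mu> (with_proj G) (\<lambda>_. 1) x y"

definition resolving_set :: "'a pair_pre_digraph \<Rightarrow> 'a set \<Rightarrow> bool" where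
  "resolving_set G S \<longleftrightarrow> S \<subseteq> pverts G \<and>
     (\<forall>x\<in>pverts G. \<forall>y\<in>pverts G. x \<noteq> y \<longrightarrow> (\<exists>z\<in>S. gdist G x z \<noteq> gdist G y z))"

definition connected_resolving_set :: "'a pair_pre_digraph \<Rightarrow> 'a set \<Rightarrow> bool" where
  "connected_resolving_set G S \<longleftrightarrow>
     resolving_set G S \<and> Digraph_Component.connected (with_proj G \<restriction> S)"

definition cdim :: "'a pair_pre_digraph \<Rightarrow> nat" where
  "cdim G = (LEAST k. \<exists>S. connected_resolving_set G S \<and> card S = k)"

definition is_path_graph :: "'a pair_pre_digraph \<Rightarrow> bool" where
  "is_path_graph G \<longleftrightarrow> (\<exists>p. p \<noteq> [] \<and> distinct p \<and> pverts G = set p \<and>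
     parcs G = set (vwalk_arcs p) \<union> (set (vwalk_arcs p))\<inverse>)"

text \<open>
  A drawing places the vertices at distinct points of the plane and maps each edge \<open>{x, y}\<close> to
  a simple arc between the points of \<open>x\<close> and \<open>y\<close> that passes through no other vertex; two
  distinct edges meet at most at a common end vertex.
\<close>

definition planar_drawing ::
  "'a pair_pre_digraph \<Rightarrow> ('a \<Rightarrow> real \<times> real) \<Rightarrow> ('a set \<Rightarrow> real \<Rightarrow> real \<times> real) \<Rightarrow> bool" where
  "planar_drawing G pos crv \<longleftrightarrow>
     inj_on pos (pverts G) \<and>
     (\<forall>(x, y)\<in>parcs G.
        Path_Connected.arc (crv {x, y}) \<and>
        {pathstart (crv {x, y}), pathfinish (crv {x, y})} = {pos x, pos y} \<and>
        path_image (crv {x, y}) \<inter> pos ` pverts G = {pos x, pos y}) \<and>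
     (\<forall>(x, y)\<in>parcs G. \<forall>(x', y')\<in>parcs G. {x, y} \<noteq> {x', y'} \<longrightarrow>
        path_image (crv {x, y}) \<inter> path_image (crv {x', y'}) \<subseteq> pos ` ({x, y} \<inter> {x', y'}))"

definition planar :: "'a pair_pre_digraph \<Rightarrow> bool" where
  "planar G \<longleftrightarrow> (\<exists>pos crv. planar_drawing G pos crv)"

text \<open>The index 0 is not used: the graphs below only contain vertices of index at least 1.\<close>

datatype fvertex = U | W | X nat | Y nat | Z nat

definition base_edges :: "nat \<Rightarrow> fvertex rel" where
  "base_edges r =
     {(U, W), (X 1, U), (Z 1, W), (Y 1, U), (Y 1, W)} \<union>
     (\<Union>a\<in>{2..r}. {(X a, X (a - 1)), (Z a, Z (a - 1)),
                   (X (a - 1), Y a), (Z (a - 1), Y a), (Y (a - 1), Y a)}) \<union>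
     (\<Union>a\<in>{1..r}. {(X a, Y a), (X a, Z a), (Y a, Z a)})"

text \<open>
  Each edge is named in one direction only, since \<^locale>\<open>pair_graph\<close> makes the arc relation
  symmetric. The edges \<open>x\<^sub>a y\<^sub>a\<close>, \<open>x\<^sub>a z\<^sub>a\<close>, \<open>y\<^sub>a z\<^sub>a\<close> are optional, so they occur only in the
  last condition, which says that there are no edges besides those of \<^const>\<open>base_edges\<close>.
\<close>

definition family :: "nat \<Rightarrow> fvertex pair_pre_digraph set" where
  "family r = {G. pair_graph G \<and> (U, W) \<in> parcs G \<and>
     {U, W} \<subseteq> pverts G \<and> pverts G \<subseteq> {U, W} \<union> (\<Union>a\<in>{1..r}. {X a, Y a, Z a}) \<and>
     (X 1 \<in> pverts G \<longrightarrow> (X 1, U) \<in> parcs G) \<and>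
     (Z 1 \<in> pverts G \<longrightarrow> (Z 1, W) \<in> parcs G) \<and>
     (Y 1 \<in> pverts G \<longrightarrow> (Y 1, U) \<in> parcs G \<and> (Y 1, W) \<in> parcs G) \<and>
     (\<forall>a\<in>{2..r}. X a \<in> pverts G \<longrightarrow> X (a - 1) \<in> pverts G \<and> (X a, X (a - 1)) \<in> parcs G) \<and>
     (\<forall>a\<in>{2..r}. Z a \<in> pverts G \<longrightarrow> Z (a - 1) \<in> pverts G \<and> (Z a, Z (a - 1)) \<in> parcs G) \<and>
     (\<forall>a\<in>{2..r}. Y a \<in> pverts G \<longrightarrow>
        (X (a - 1) \<in> pverts G \<and> Z (a - 1) \<in> pverts G \<and>
           (X (a - 1), Y a) \<in> parcs G \<and> (Z (a - 1), Y a) \<in> parcs G) \<or>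
        (Y (a - 1) \<in> pverts G \<and> (Y (a - 1), Y a) \<in> parcs G)) \<and>
     parcs G \<subseteq> base_edges r \<union> (base_edges r)\<inverse>}"

definition in_family :: "'a pair_pre_digraph \<Rightarrow> nat \<Rightarrow> bool" where
  "in_family G r \<longleftrightarrow> (\<exists>H\<in>family r. digraph_iso (with_proj G) (with_proj H))"

end

theory Submission
  imports Defs
begin

text \<open>
  A connected resolving set of size two is an edge \<open>u w\<close> whose two distance functions
  together separate all vertices. Since the distances of a vertex to two adjacent vertices differ
  by at most one, every vertex \<open>v\<close> has a pair of coordinates \<open>(d(v, u), d(v, w))\<close> of
  the form \<open>(a, a + 1)\<close>, \<open>(a, a)\<close> or \<open>(a + 1, a)\<close>, and these are the names
  \<open>x\<^sub>a\<close>, \<open>y\<^sub>a\<close>, \<open>z\<^sub>a\<close> of the family, with \<open>u\<close> in the role of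
  \<open>x\<^sub>0\<close> and \<open>w\<close> in the role of \<open>z\<^sub>0\<close>. The edge \<open>u w\<close> resolves exactly
  when no two vertices get the same name.

  The defining conditions of the family say precisely that these names are true: an integer function
  on the vertices is the distance to \<open>z\<close> if and only if it vanishes at \<open>z\<close>, changes by at
  most one along each edge, and decreases along some edge at every other vertex
  (\<open>gdist_distance_profile\<close>, \<open>ex_distance_profile\<close>). The list of permitted edges is
  the condition of slow change for both coordinates, and the required edges are the descending ones
  (\<open>family_imp_profiles\<close>, \<open>profiles_imp_family\<close>). Hence \<open>G\<close> belongs to the family
  if and only if some edge resolves it (\<open>in_family_iff_resolving_edge\<close>).

  A connected resolving set of size one is a vertex from which all distances are distinct; then each
  distance occurs once and the graph is a path that starts at this vertex
  (\<open>is_path_graph_iff_resolving_singleton\<close>). As all vertices together form a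
  connected resolving set, the two descriptions determine when the dimension is two
  (\<open>cdim_eq_2_iff\<close>).

  For planarity, the vertices \<open>x\<^sub>a, y\<^sub>a, z\<^sub>a\<close> are placed on three rays from the origin as
  the corners of nested homothetic triangles. Straight edges then join points of one triangle or of
  two consecutive ones, and no two of them cross, because each point of the plane determines the only
  vertex or edge that can pass through it (\<open>planar_if_cell\<close>, \<open>cell_layered_edge\<close>).
\<close>

section \<open>Distances as potentials\<close>

text \<open>
  A local characterisation of the distance to \<open>z\<close>. It speaks of single arcs only, so that it
  can be compared with the edge conditions of the family and transported along isomorphisms
  without any reference to walks.
\<close>

definition distance_profile :: "'a pair_pre_digraph \<Rightarrow> 'a \<Rightarrow> ('a \<Rightarrow> nat) \<Rightarrow> bool" where
  "distance_profile G z \<delta> \<longleftrightarrow> z \<in> pverts G \<and> \<delta> z = 0 \<and>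
     (\<forall>(x, y)\<in>parcs G. \<delta> x \<le> Suc (\<delta> y)) \<and>
     (\<forall>x\<in>pverts G. x \<noteq> z \<longrightarrow> (\<exists>y. (x, y) \<in> parcs G \<and> \<delta> x = Suc (\<delta> y)))"

lemma distance_profile_eq_0_iff:
  assumes "distance_profile G z \<delta>" "x \<in> pverts G"
  shows "\<delta> x = 0 \<longleftrightarrow> x = z"
  using assms unfolding distance_profile_def by force

lemma distance_profile_cong:
  assumes "pair_wf_digraph G" "\<And>x. x \<in> pverts G \<Longrightarrow> \<delta> x = \<epsilon> x"
  shows "distance_profile G z \<delta> \<longleftrightarrow> distance_profile G z \<epsilon>"
proof -
  interpret pair_wf_digraph G by fact
  have "\<delta> x = \<epsilon> x \<and> \<delta> y = \<epsilon> y" if "(x, y) \<in> parcs G" for x y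
    using that assms(2) by (blast intro: wellformed')
  note eq = this
  have "(\<forall>(x, y)\<in>parcs G. \<delta> x \<le> Suc (\<delta> y)) \<longleftrightarrow> (\<forall>(x, y)\<in>parcs G. \<epsilon> x \<le> Suc (\<epsilon> y))"
    using eq by (intro ball_cong) auto
  moreover have "(\<exists>y. (x, y) \<in> parcs G \<and> \<delta> x = Suc (\<delta> y)) \<longleftrightarrow>
      (\<exists>y. (x, y) \<in> parcs G \<and> \<epsilon> x = Suc (\<epsilon> y))" for x
    using eq by (intro ex_cong1) auto
  ultimately show ?thesis
    using assms(2)[of z] unfolding distance_profile_def by (simp cong: conj_cong)
qed

context pair_wf_digraph begin

text \<open>
  Each arc of a walk to \<open>z\<close> lowers \<open>\<delta>\<close> by at most one, and \<open>\<delta>\<close> ends at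
  \<open>0\<close>.
\<close>

lemma distance_profile_le_length:
  assumes "distance_profile G z \<delta>" "awalk x p z"
  shows "\<delta> x \<le> length p"
  using assms(2)
proof (induction p arbitrary: x)
  case Nil
  then show ?case using assms(1) by (auto simp: awalk_Nil_iff distance_profile_def)
next
  case (Cons e p)
  then have "(x, snd e) \<in> parcs G" "awalk (snd e) p z"
    by (auto simp: awalk_Cons_iff)
  then show ?case
    using Cons.IH[of "snd e"] assms(1) by (fastforce simp: distance_profile_def)
qed

text \<open>
  Following descending arcs yields a walk that attains the lower bound.
\<close>

lemma distance_profile_ex_awalk:
  assumes "distance_profile G z \<delta>" "x \<in> pverts G"
  shows "\<exists>p. awalk x p z \<and> length p = \<delta> x"
  using assms(2)
proof (induction "\<delta> x" arbitrary: x)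
  case 0
  then have "x = z" using distance_profile_eq_0_iff[OF assms(1)] by auto
  with 0 show ?case by (intro exI[of _ "[]"]) (auto simp: awalk_Nil_iff)
next
  case (Suc n)
  then have "x \<noteq> z" using distance_profile_eq_0_iff[OF assms(1), of x] by auto
  then obtain y where y: "(x, y) \<in> parcs G" "\<delta> x = Suc (\<delta> y)"
    using assms(1) Suc.prems unfolding distance_profile_def by blast
  then obtain p where "awalk y p z" "length p = \<delta> y"
    using Suc.hyps(1)[of y] Suc.hyps(2) in_arcsD2[OF y(1)] by auto
  then show ?case
    using y Suc.prems by (intro exI[of _ "(x, y) # p"]) (auto simp: awalk_Cons_iff)
qed

lemma gdist_distance_profile:
  assumes "distance_profile G z \<delta>" "x \<in> pverts G"
  shows "gdist G x z = ereal (real (\<delta> x))"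
proof (rule antisym)
  have cost: "awalk_cost (\<lambda>_. 1) p = real (length p)" for p
    by (induction p) auto
  show "gdist G x z \<le> ereal (real (\<delta> x))"
    using distance_profile_ex_awalk[OF assms] min_cost_le_walk_cost[of x _ z "\<lambda>_. 1"]
    unfolding gdist_def cost by metis
  show "ereal (real (\<delta> x)) \<le> gdist G x z"
    using distance_profile_le_length[OF assms(1)]
    by (auto simp: gdist_def \<mu>_def cost intro!: INF_greatest)
qed

end

lemma (in pair_graph) ex_distance_profile:
  assumes "Digraph_Component.connected (with_proj G)" "z \<in> pverts G"
  shows "\<exists>\<delta>. distance_profile G z \<delta>"
proof -
  define \<delta> where "\<delta> x = (LEAST n. \<exists>p. awalk x p z \<and> length p = n)" for x
  have sc: "strongly_connected (with_proj G)"
    using assms(1) pair_sym_arcs by (intro symmetric_connected_imp_strongly_connected)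
  have shortest: "\<exists>p. awalk x p z \<and> length p = \<delta> x" if "x \<in> pverts G" for x
  proof -
    have "\<exists>p. awalk x p z"
      using sc that assms(2) reachable_awalk by (auto simp: strongly_connected_def)
    then have "\<exists>n p. awalk x p z \<and> length p = n" by blast
    then show ?thesis unfolding \<delta>_def by (rule LeastI_ex)
  qed
  have le: "\<delta> x \<le> length p" if "awalk x p z" for x p
    unfolding \<delta>_def using that by (blast intro: Least_le)
  have arc_le: "\<delta> x \<le> Suc (\<delta> y)" if xy: "(x, y) \<in> parcs G" for x y
  proof -
    obtain p where "awalk y p z" "length p = \<delta> y" using shortest xy wellformed' by blast
    then show ?thesis
      using le[of x "(x, y) # p"] xy by (auto simp: awalk_Cons_iff intro: wellformed')
  qed
  have "\<exists>y. (x, y) \<in> parcs G \<and> \<delta> x = Suc (\<delta> y)" if x: "x \<in> pverts G" "x \<noteq> z" for x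
  proof -
    obtain p where p: "awalk x p z" "length p = \<delta> x" using shortest x by blast
    then obtain e q where "p = e # q" using x by (cases p) (auto simp: awalk_Nil_iff)
    with p have "(x, snd e) \<in> parcs G" "\<delta> (snd e) \<le> length q" "\<delta> x = Suc (length q)"
      by (auto simp: awalk_Cons_iff intro: le)
    then show ?thesis using arc_le by fastforce
  qed
  moreover have "\<delta> z = 0" using le[of z "[]"] assms(2) by (auto simp: awalk_Nil_iff)
  ultimately have "distance_profile G z \<delta>"
    using arc_le assms(2) unfolding distance_profile_def by blast
  then show ?thesis by blast
qed

text \<open>
  A shortest walk to one end of the edge \<open>u w\<close> can be prolonged by this edge to the other end.
\<close>

lemma distance_profiles_adjacent:
  assumes "pair_graph G" "(u, w) \<in> parcs G"
    and \<delta>: "distance_profile G u \<delta>" and \<epsilon>: "distance_profile G w \<epsilon>" and "x \<in> pverts G"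
  shows "\<delta> x \<le> Suc (\<epsilon> x) \<and> \<epsilon> x \<le> Suc (\<delta> x)"
proof -
  interpret pair_graph G by fact
  have wu: "(w, u) \<in> parcs G" using assms(2) by (rule arcs_symmetric)
  obtain p where p: "awalk x p u" "length p = \<delta> x"
    using distance_profile_ex_awalk[OF \<delta> assms(5)] by blast
  obtain q where q: "awalk x q w" "length q = \<epsilon> x"
    using distance_profile_ex_awalk[OF \<epsilon> assms(5)] by blast
  have "awalk x (p @ [(u, w)]) w"
    using p(1) assms(2) by (intro awalk_appendI[of _ _ u]) (auto simp: awalk_simps dest: wellformed')
  moreover have "awalk x (q @ [(w, u)]) u"
    using q(1) wu by (intro awalk_appendI[of _ _ w]) (auto simp: awalk_simps dest: wellformed')
  ultimately show ?thesis
    using distance_profile_le_length[OF \<delta>, of x "q @ [(w, u)]"]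
      distance_profile_le_length[OF \<epsilon>, of x "p @ [(u, w)]"] p(2) q(2) by simp
qed

lemma (in pair_wf_digraph) resolving_set_profiles:
  assumes "\<And>z. z \<in> S \<Longrightarrow> distance_profile G z (\<delta> z)"
  shows "resolving_set G S \<longleftrightarrow>
    (\<forall>x\<in>pverts G. \<forall>y\<in>pverts G. (\<forall>z\<in>S. \<delta> z x = \<delta> z y) \<longrightarrow> x = y)"
proof -
  have "S \<subseteq> pverts G" using assms by (auto simp: distance_profile_def)
  moreover have "gdist G x z = ereal (real (\<delta> z x))" if "x \<in> pverts G" "z \<in> S" for x z
    using that assms by (intro gdist_distance_profile) auto
  ultimately show ?thesis unfolding resolving_set_def by force
qed

section \<open>Paths and resolving vertices\<close>

lemma set_vwalk_arcs_nth:
  "set (vwalk_arcs p) = {(p ! i, p ! Suc i) | i. Suc i < length p}"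
proof (induction p rule: vwalk_arcs.induct)
  case (3 x y xs)
  have "{(((x # y # xs) ! i), (x # y # xs) ! Suc i) | i. Suc i < length (x # y # xs)} =
      insert (x, y) {((y # xs) ! i, (y # xs) ! Suc i) | i. Suc i < length (y # xs)}"
    (is "?L = ?R")
  proof
    show "?L \<subseteq> ?R"
    proof
      fix e assume "e \<in> ?L"
      then obtain i where i: "e = ((x # y # xs) ! i, (x # y # xs) ! Suc i)" "i < Suc (length xs)"
        by auto
      then show "e \<in> ?R" by (cases i) auto
    qed
    have "(x, y) \<in> ?L" by (auto intro!: exI[of _ 0])
    moreover have "((y # xs) ! i, (y # xs) ! Suc i) \<in> ?L" if "Suc i < length (y # xs)" for i
      using that by (auto intro!: exI[of _ "Suc i"])
    ultimately show "?R \<subseteq> ?L" by blast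
  qed
  then show ?case using 3 by simp
qed auto

lemma is_path_graph_imp_profile:
  assumes "is_path_graph G"
  shows "\<exists>z \<delta>. distance_profile G z \<delta> \<and> inj_on \<delta> (pverts G)"
proof -
  obtain p where p: "p \<noteq> []" "distinct p" "pverts G = set p"
    and E: "parcs G = set (vwalk_arcs p) \<union> (set (vwalk_arcs p))\<inverse>"
    using assms unfolding is_path_graph_def by blast
  define \<delta> where "\<delta> = inv_into {..<length p} ((!) p)"
  have inj: "inj_on ((!) p) {..<length p}" using p(2) by (simp add: inj_on_nth)
  have nth: "\<delta> (p ! i) = i" if "i < length p" for i
    unfolding \<delta>_def using inv_into_f_f[OF inj] that by simp
  have E: "parcs G = {(p ! i, p ! Suc i) | i. Suc i < length p} \<union>
      {(p ! Suc i, p ! i) | i. Suc i < length p}"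
    unfolding E set_vwalk_arcs_nth by auto
  have V: "x \<in> pverts G \<longleftrightarrow> (\<exists>i<length p. x = p ! i)" for x
    unfolding p(3) by (auto simp: in_set_conv_nth)
  have "\<exists>y. (x, y) \<in> parcs G \<and> \<delta> x = Suc (\<delta> y)" if x: "x \<in> pverts G" "x \<noteq> p ! 0" for x
  proof -
    obtain i where i: "Suc i < length p" "x = p ! Suc i"
      using x V by (metis not0_implies_Suc)
    then have "(x, p ! i) \<in> parcs G" using E by blast
    then show ?thesis using i nth[of i] nth[of "Suc i"] by auto
  qed
  moreover have "\<delta> x \<le> Suc (\<delta> y)" if xy: "(x, y) \<in> parcs G" for x y
  proof -
    obtain i where "Suc i < length p" "x = p ! i \<and> y = p ! Suc i \<or> x = p ! Suc i \<and> y = p ! i"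
      using xy unfolding E by blast
    then show ?thesis using nth[of i] nth[of "Suc i"] by auto
  qed
  moreover have "p ! 0 \<in> pverts G" "\<delta> (p ! 0) = 0" using p(1,3) nth[of 0] by simp_all
  ultimately have "distance_profile G (p ! 0) \<delta>" unfolding distance_profile_def by blast
  moreover have "inj_on \<delta> (pverts G)"
    by (rule inj_onI) (metis V nth)
  ultimately show ?thesis by blast
qed

text \<open>
  The values of \<open>\<delta>\<close> are closed downwards, because descending arcs pass through every smaller
  value; so the vertices can be listed as \<open>g 0, \<dots>, g m\<close> by their value. An arc joins distinct
  vertices whose values differ by at most one, hence consecutive ones. Conversely, the descending arc
  at \<open>g (i + 1)\<close> can only lead to \<open>g i\<close>.
\<close>

lemma profile_imp_is_path_graph:
  assumes "pair_graph G" and profile: "distance_profile G z \<delta>" and inj: "inj_on \<delta> (pverts G)"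
  shows "is_path_graph G"
proof -
  interpret pair_graph G by fact
  define m where "m = Max (\<delta> ` pverts G)"
  define g where "g = inv_into (pverts G) \<delta>"
  have z: "z \<in> pverts G" using profile by (simp add: distance_profile_def)
  have below: "\<exists>y\<in>pverts G. \<delta> y = k" if "x \<in> pverts G" "k \<le> \<delta> x" for x k
    using that
  proof (induction "\<delta> x" arbitrary: x)
    case 0
    then show ?case by auto
  next
    case (Suc n)
    show ?case
    proof (cases "k = \<delta> x")
      case False
      have "x \<noteq> z" using Suc.hyps(2) profile by (auto simp: distance_profile_def)
      then obtain y where "(x, y) \<in> parcs G" "\<delta> x = Suc (\<delta> y)"
        using profile Suc.prems(1) unfolding distance_profile_def by blast
      then show ?thesis
        using Suc.hyps(1)[of y] Suc.hyps(2) Suc.prems(2) False in_arcsD2[of x y] by auto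
    qed (use Suc.prems in auto)
  qed
  have "m \<in> \<delta> ` pverts G" unfolding m_def using z pair_finite_verts by (intro Max_in) auto
  then obtain x where x: "x \<in> pverts G" "\<delta> x = m" by auto
  have le_m: "\<delta> x \<le> m" if "x \<in> pverts G" for x
    unfolding m_def using that pair_finite_verts by simp
  have image: "\<delta> ` pverts G = {..m}"
    using below[OF x(1)] x(2) le_m by (auto simp: image_iff)
  have g: "g k \<in> pverts G" "\<delta> (g k) = k" if "k \<le> m" for k
    using that image inv_into_into[of k \<delta> "pverts G"] f_inv_into_f[of k \<delta> "pverts G"]
    by (auto simp: g_def)
  have g_\<delta>: "g (\<delta> x) = x" if "x \<in> pverts G" for x
    unfolding g_def using inj that by (rule inv_into_f_f)
  define p where "p = map g [0..<Suc m]"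
  have len: "length p = Suc m" by (simp add: p_def)
  have nth: "p ! i = g i" if "i \<le> m" for i
    using that by (simp add: p_def nth_map[of _ "[0..<Suc m]"] del: upt_Suc)
  have "inj_on g {..m}" using g(2) by (metis atMost_iff inj_onI)
  then have "distinct p" by (simp add: p_def distinct_map atLeast0LessThan lessThan_Suc_atMost del: upt_Suc)
  moreover have "pverts G = set p"
  proof -
    have "set p = g ` {..m}" by (simp add: p_def atLeast0LessThan lessThan_Suc_atMost del: upt_Suc)
    also have "\<dots> = pverts G"
    proof
      show "g ` {..m} \<subseteq> pverts G" using g(1) by auto
      show "pverts G \<subseteq> g ` {..m}"
        using g_\<delta> le_m by (metis atMost_iff imageI subsetI)
    qed
    finally show ?thesis ..
  qed
  moreover have "parcs G = set (vwalk_arcs p) \<union> (set (vwalk_arcs p))\<inverse>"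
  proof -
    have arcs_p: "set (vwalk_arcs p) = {(g i, g (Suc i)) | i. i < m}"
      unfolding set_vwalk_arcs_nth len by (intro Collect_cong ex_cong1) (auto simp: nth)
    have down: "(g (Suc i), g i) \<in> parcs G" if i: "i < m" for i
    proof -
      have "g (Suc i) \<noteq> z" using g(2)[of "Suc i"] i profile by (auto simp: distance_profile_def)
      then obtain y where y: "(g (Suc i), y) \<in> parcs G" "\<delta> (g (Suc i)) = Suc (\<delta> y)"
        using profile g(1)[of "Suc i"] i unfolding distance_profile_def by auto
      then have "y = g i" using g(2)[of "Suc i"] i g_\<delta>[of y] in_arcsD2[OF y(1)] by simp
      then show ?thesis using y by simp
    qed
    have step: "\<delta> y = Suc (\<delta> x) \<or> \<delta> x = Suc (\<delta> y)" if xy: "(x, y) \<in> parcs G" for x y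
    proof -
      have "\<delta> x \<le> Suc (\<delta> y)" "\<delta> y \<le> Suc (\<delta> x)"
        using profile xy arcs_symmetric[OF xy] unfolding distance_profile_def by blast+
      moreover have "\<delta> x \<noteq> \<delta> y"
        using no_loops'[OF xy] inj_onD[OF inj] in_arcsD1[OF xy] in_arcsD2[OF xy] by blast
      ultimately show ?thesis by linarith
    qed
    show ?thesis
    proof (intro equalityI subrelI)
      fix x y assume xy: "(x, y) \<in> parcs G"
      then have "x \<in> pverts G" "y \<in> pverts G" by (auto dest: wellformed')
      with step[OF xy] g_\<delta> le_m[of x] le_m[of y]
      have "x = g (\<delta> x) \<and> y = g (Suc (\<delta> x)) \<and> \<delta> x < m \<or> x = g (Suc (\<delta> y)) \<and> y = g (\<delta> y) \<and> \<delta> y < m"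
        by (metis Suc_le_eq)
      then show "(x, y) \<in> set (vwalk_arcs p) \<union> (set (vwalk_arcs p))\<inverse>"
        unfolding arcs_p by blast
    next
      fix x y assume "(x, y) \<in> set (vwalk_arcs p) \<union> (set (vwalk_arcs p))\<inverse>"
      then show "(x, y) \<in> parcs G" unfolding arcs_p using down arcs_symmetric by blast
    qed
  qed
  moreover have "p \<noteq> []" by (simp add: p_def)
  ultimately show ?thesis unfolding is_path_graph_def by blast
qed

lemma is_path_graph_iff_resolving_singleton:
  assumes "pair_graph G" "Digraph_Component.connected (with_proj G)"
  shows "is_path_graph G \<longleftrightarrow> (\<exists>z. resolving_set G {z})"
proof -
  interpret pair_graph G by fact
  have resolving: "resolving_set G {z} \<longleftrightarrow> inj_on \<delta> (pverts G)" if "distance_profile G z \<delta>" for z \<delta>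
    using resolving_set_profiles[of "{z}" "\<lambda>_. \<delta>"] that by (auto simp: inj_on_def)
  show ?thesis
  proof
    assume "is_path_graph G"
    then show "\<exists>z. resolving_set G {z}" using is_path_graph_imp_profile resolving by blast
  next
    assume "\<exists>z. resolving_set G {z}"
    then obtain z where z: "resolving_set G {z}" by blast
    then have "z \<in> pverts G" by (simp add: resolving_set_def)
    then obtain \<delta> where \<delta>: "distance_profile G z \<delta>" using ex_distance_profile assms(2) by blast
    then show "is_path_graph G"
      using z resolving[OF \<delta>] profile_imp_is_path_graph[OF assms(1) \<delta>] by simp
  qed
qed

section \<open>Isomorphic copies\<close>

definition map_graph :: "('a \<Rightarrow> 'b) \<Rightarrow> 'a pair_pre_digraph \<Rightarrow> 'b pair_pre_digraph" where
  "map_graph f G = \<lparr>pverts = f ` pverts G, parcs = map_prod f f ` parcs G\<rparr>"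

text \<open>
  The arcs of a pair graph are the pairs of their ends, so the action of an isomorphism on the arcs
  is determined by its action on the vertices.
\<close>

lemma digraph_iso_with_proj_iff:
  assumes "pair_wf_digraph G"
  shows "digraph_iso (with_proj G) (with_proj H) \<longleftrightarrow>
    (\<exists>f. inj_on f (pverts G) \<and> H = map_graph f G)"
proof -
  interpret pair_wf_digraph G by fact
  show ?thesis
  proof
    assume "digraph_iso (with_proj G) (with_proj H)"
    then obtain hom where hom: "digraph_isomorphism hom" and H: "with_proj H = app_iso hom (with_proj G)"
      unfolding digraph_iso_def by blast
    have tails: "iso_tail hom = fst" "iso_head hom = snd"
      using arg_cong[OF H, of tail] arg_cong[OF H, of head] by simp_all
    have "iso_arcs hom e = map_prod (iso_verts hom) (iso_verts hom) e" if "e \<in> parcs G" for e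
      using hom that unfolding digraph_isomorphism_def tails
      by (auto simp: prod_eq_iff)
    then have "iso_arcs hom ` parcs G = map_prod (iso_verts hom) (iso_verts hom) ` parcs G"
      by (rule image_cong[OF refl])
    then have "H = map_graph (iso_verts hom) G"
      using arg_cong[OF H, of verts] arg_cong[OF H, of arcs]
      by (simp add: map_graph_def)
    moreover have "inj_on (iso_verts hom) (pverts G)"
      using hom unfolding digraph_isomorphism_def by simp
    ultimately show "\<exists>f. inj_on f (pverts G) \<and> H = map_graph f G" by blast
  next
    assume "\<exists>f. inj_on f (pverts G) \<and> H = map_graph f G"
    then obtain f where f: "inj_on f (pverts G)" "H = map_graph f G" by blast
    define hom where
      "hom = \<lparr>iso_verts = f, iso_arcs = map_prod f f, iso_head = snd, iso_tail = fst\<rparr>"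
    have "inj_on (map_prod f f) (parcs G)"
      using map_prod_inj_on[OF f(1) f(1)] by (rule inj_on_subset) (auto intro: wellformed')
    then have "digraph_isomorphism hom"
      using f(1) wf_digraph unfolding digraph_isomorphism_def by (simp add: hom_def)
    moreover have "with_proj H = app_iso hom (with_proj G)"
      by (simp add: f(2) map_graph_def app_iso_def hom_def with_proj_def)
    ultimately show "digraph_iso (with_proj G) (with_proj H)"
      unfolding digraph_iso_def by blast
  qed
qed

lemma pair_graph_map_graph:
  assumes "pair_graph G" "inj_on f (pverts G)"
  shows "pair_graph (map_graph f G)"
proof -
  interpret pair_graph G by fact
  show ?thesis
  proof
    fix e assume "e \<in> parcs (map_graph f G)"
    then obtain x y where xy: "(x, y) \<in> parcs G" "e = (f x, f y)" by (auto simp: map_graph_def)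
    then show "fst e \<in> pverts (map_graph f G)" "snd e \<in> pverts (map_graph f G)"
      using wellformed' by (auto simp: map_graph_def)
    have "x \<noteq> y" "x \<in> pverts G" "y \<in> pverts G" using xy(1) no_loops' wellformed' by auto
    then show "fst e \<noteq> snd e" using xy(2) assms(2) by (auto dest: inj_onD)
  next
    show "symmetric (with_proj (map_graph f G))"
      using arcs_symmetric by (force simp: symmetric_def map_graph_def intro!: symI)
  qed (auto simp: map_graph_def pair_finite_verts pair_finite_arcs)
qed

lemma distance_profile_map_graph:
  assumes "pair_wf_digraph G" "inj_on f (pverts G)" "z \<in> pverts G"
  shows "distance_profile (map_graph f G) (f z) \<delta> \<longleftrightarrow> distance_profile G z (\<delta> \<circ> f)"
proof -
  interpret pair_wf_digraph G by fact
  have "(\<exists>y. (f x, y) \<in> parcs (map_graph f G) \<and> \<delta> (f x) = Suc (\<delta> y)) \<longleftrightarrow>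
      (\<exists>y. (x, y) \<in> parcs G \<and> \<delta> (f x) = Suc (\<delta> (f y)))" if "x \<in> pverts G" for x
  proof
    assume "\<exists>y. (f x, y) \<in> parcs (map_graph f G) \<and> \<delta> (f x) = Suc (\<delta> y)"
    then obtain x' y where y: "(x', y) \<in> parcs G" "f x = f x'" "\<delta> (f x) = Suc (\<delta> (f y))"
      by (auto simp: map_graph_def)
    have "x = x'" using inj_onD[OF assms(2) y(2) that in_arcsD1[OF y(1)]] .
    then show "\<exists>y. (x, y) \<in> parcs G \<and> \<delta> (f x) = Suc (\<delta> (f y))"
      using y(1,3) by (intro exI[of _ y]) simp
  qed (force simp: map_graph_def)
  moreover have "f x = f z \<longleftrightarrow> x = z" if "x \<in> pverts G" for x
    using that assms(2,3) by (auto dest: inj_onD)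
  ultimately show ?thesis
    using assms(3) by (auto simp: distance_profile_def map_graph_def)
qed

section \<open>The family in distance coordinates\<close>

text \<open>
  Along the rails the vertices \<open>U\<close> and \<open>W\<close> continue the sequences of the \<open>X a\<close>
  and the \<open>Z a\<close> to index \<open>0\<close>; the edges at \<open>U\<close> and \<open>W\<close> then follow the
  same pattern as all others.
\<close>

definition x_rail :: "nat \<Rightarrow> fvertex" where "x_rail a = (if a = 0 then U else X a)"
definition z_rail :: "nat \<Rightarrow> fvertex" where "z_rail a = (if a = 0 then W else Z a)"

text \<open>
  The coordinates that the name of a vertex stands for: its distances to \<open>U\<close> and to
  \<open>W\<close>.
\<close>

primrec level_u :: "fvertex \<Rightarrow> nat" where
  "level_u U = 0" | "level_u W = 1" | "level_u (X a) = a" | "level_u (Y a) = a" |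
  "level_u (Z a) = Suc a"

primrec level_w :: "fvertex \<Rightarrow> nat" where
  "level_w U = 1" | "level_w W = 0" | "level_w (X a) = Suc a" | "level_w (Y a) = a" |
  "level_w (Z a) = a"

text \<open>
  Inverse to the pair of levels on coordinates that differ by at most one.
\<close>

definition at_levels :: "nat \<Rightarrow> nat \<Rightarrow> fvertex" where
  "at_levels i j = (if i = j then Y i else if i < j then (if i = 0 then U else X i)
     else (if j = 0 then W else Z j))"

definition ladder_vertices :: "nat \<Rightarrow> fvertex set" where
  "ladder_vertices r = {U, W} \<union> (\<Union>a\<in>{1..r}. {X a, Y a, Z a})"

lemma levels_at_levels:
  assumes "i \<le> Suc j" "j \<le> Suc i"
  shows "level_u (at_levels i j) = i" "level_w (at_levels i j) = j"
  using assms by (auto simp: at_levels_def)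

lemma at_levels_levels:
  assumes "v \<in> ladder_vertices r"
  shows "at_levels (level_u v) (level_w v) = v"
  using assms by (auto simp: at_levels_def ladder_vertices_def)

lemma base_edges_levels:
  assumes "(v, w) \<in> base_edges r \<union> (base_edges r)\<inverse>"
  shows "level_u v \<le> Suc (level_u w)" "level_w v \<le> Suc (level_w w)"
  using assms by (auto simp: base_edges_def)

text \<open>
  Together with \<open>base_edges_levels\<close> this explains the list of permitted edges: it consists of
  all pairs of distinct vertices whose two levels both differ by at most one.
\<close>

lemma base_edgesI:
  assumes "v \<in> ladder_vertices r" "w \<in> ladder_vertices r" "v \<noteq> w"
    and "level_u v \<le> Suc (level_u w)" "level_u w \<le> Suc (level_u v)"
    and "level_w v \<le> Suc (level_w w)" "level_w w \<le> Suc (level_w v)"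
  shows "(v, w) \<in> base_edges r \<union> (base_edges r)\<inverse>"
  using assms
  by (cases v; cases w) (auto simp: base_edges_def ladder_vertices_def le_Suc_eq)

lemma levels_rails [simp]:
  "level_u (x_rail a) = a" "level_w (x_rail a) = Suc a" "level_u (z_rail a) = Suc a" "level_w (z_rail a) = a"
  by (simp_all add: x_rail_def z_rail_def)

text \<open>
  Lowering the distance to \<open>U\<close> by one while changing the distance to \<open>W\<close> by at most one
  leaves a single candidate below \<open>X a\<close> and two below \<open>Y a\<close>. The prescribed edges are
  exactly these; \<open>Y a\<close> has two alternatives because an edge to \<open>Y (a - 1)\<close> descends towards
  \<open>U\<close> and \<open>W\<close> at once, whereas otherwise one edge is needed for each of them.
\<close>

lemma descending_neighbours_u:
  assumes "v \<in> ladder_vertices r" "w \<in> ladder_vertices r"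
    and "level_w v \<le> Suc (level_w w)" "level_w w \<le> Suc (level_w v)"
    and "level_u v = Suc (level_u w)"
  shows "v = X a \<Longrightarrow> w = x_rail (a - 1)" "v = Y a \<Longrightarrow> w = x_rail (a - 1) \<or> w = Y (a - 1)"
  using assms by (cases w; auto simp: ladder_vertices_def x_rail_def)+

lemma descending_neighbours_w:
  assumes "v \<in> ladder_vertices r" "w \<in> ladder_vertices r"
    and "level_u v \<le> Suc (level_u w)" "level_u w \<le> Suc (level_u v)"
    and "level_w v = Suc (level_w w)"
  shows "v = Z a \<Longrightarrow> w = z_rail (a - 1)" "v = Y a \<Longrightarrow> w = z_rail (a - 1) \<or> w = Y (a - 1)"
  using assms by (cases w; auto simp: ladder_vertices_def z_rail_def)+

text \<open>
  The case distinction between index \<open>1\<close> and larger indices disappears with the rails. In the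
  last clause \<open>Y (a - 1)\<close> is no candidate for \<open>a = 1\<close>, since \<open>Y 0\<close> is not a vertex.
\<close>

lemma family_iff:
  "H \<in> family r \<longleftrightarrow> pair_graph H \<and> (U, W) \<in> parcs H \<and> pverts H \<subseteq> ladder_vertices r \<and>
     parcs H \<subseteq> base_edges r \<union> (base_edges r)\<inverse> \<and>
     (\<forall>a. X a \<in> pverts H \<longrightarrow> (X a, x_rail (a - 1)) \<in> parcs H) \<and>
     (\<forall>a. Z a \<in> pverts H \<longrightarrow> (Z a, z_rail (a - 1)) \<in> parcs H) \<and>
     (\<forall>a. Y a \<in> pverts H \<longrightarrow>
        (Y a, x_rail (a - 1)) \<in> parcs H \<and> (Y a, z_rail (a - 1)) \<in> parcs H \<or>
        (Y a, Y (a - 1)) \<in> parcs H)"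
  (is "_ \<longleftrightarrow> ?R")
proof (cases "pair_graph H \<and> (U, W) \<in> parcs H \<and> pverts H \<subseteq> ladder_vertices r \<and>
    parcs H \<subseteq> base_edges r \<union> (base_edges r)\<inverse>")
  case False
  then show ?thesis unfolding family_def ladder_vertices_def by blast
next
  case True
  then interpret pair_graph H by blast
  have sym: "(x, y) \<in> parcs H \<longleftrightarrow> (y, x) \<in> parcs H" for x y
    using arcs_symmetric by blast
  have V: "pverts H \<subseteq> ladder_vertices r" "(U, W) \<in> parcs H" using True by blast+
  have UW: "U \<in> pverts H" "W \<in> pverts H" using V(2) by (blast dest: wellformed')+
  have index: "a \<in> {1..r}" if "X a \<in> pverts H \<or> Y a \<in> pverts H \<or> Z a \<in> pverts H" for a
    using that V(1) by (auto simp: ladder_vertices_def)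
  have split: "(\<forall>a. P a \<longrightarrow> Q a) \<longleftrightarrow> (P 1 \<longrightarrow> Q 1) \<and> (\<forall>a\<in>{2..r}. P a \<longrightarrow> Q a)"
    if "\<And>a. P a \<Longrightarrow> a \<in> {1..r}" for P Q :: "nat \<Rightarrow> bool"
  proof -
    have "a = 1 \<or> a \<in> {2..r}" if "P a" for a
      using \<open>\<And>a. P a \<Longrightarrow> a \<in> {1..r}\<close>[OF that] by auto
    then show ?thesis by blast
  qed
  have X: "(\<forall>a. X a \<in> pverts H \<longrightarrow> (X a, x_rail (a - 1)) \<in> parcs H) \<longleftrightarrow>
      (X 1 \<in> pverts H \<longrightarrow> (X 1, U) \<in> parcs H) \<and>
      (\<forall>a\<in>{2..r}. X a \<in> pverts H \<longrightarrow> X (a - 1) \<in> pverts H \<and> (X a, X (a - 1)) \<in> parcs H)"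
    using in_arcsD2 by (subst split[OF index[OF disjI1]]) (auto simp: x_rail_def)
  have Z: "(\<forall>a. Z a \<in> pverts H \<longrightarrow> (Z a, z_rail (a - 1)) \<in> parcs H) \<longleftrightarrow>
      (Z 1 \<in> pverts H \<longrightarrow> (Z 1, W) \<in> parcs H) \<and>
      (\<forall>a\<in>{2..r}. Z a \<in> pverts H \<longrightarrow> Z (a - 1) \<in> pverts H \<and> (Z a, Z (a - 1)) \<in> parcs H)"
    using in_arcsD2 by (subst split[OF index[OF disjI2[OF disjI2]]]) (auto simp: z_rail_def)
  have "(Y 1, Y 0) \<notin> parcs H" using in_arcsD2 index by force
  then have Y: "(\<forall>a. Y a \<in> pverts H \<longrightarrow>
        (Y a, x_rail (a - 1)) \<in> parcs H \<and> (Y a, z_rail (a - 1)) \<in> parcs H \<or>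
        (Y a, Y (a - 1)) \<in> parcs H) \<longleftrightarrow>
      (Y 1 \<in> pverts H \<longrightarrow> (Y 1, U) \<in> parcs H \<and> (Y 1, W) \<in> parcs H) \<and>
      (\<forall>a\<in>{2..r}. Y a \<in> pverts H \<longrightarrow>
        (X (a - 1) \<in> pverts H \<and> Z (a - 1) \<in> pverts H \<and>
           (X (a - 1), Y a) \<in> parcs H \<and> (Z (a - 1), Y a) \<in> parcs H) \<or>
        (Y (a - 1) \<in> pverts H \<and> (Y (a - 1), Y a) \<in> parcs H))"
    unfolding sym[of "X b" "Y a" for a b] sym[of "Z b" "Y a" for a b]
      sym[of "Y (a - 1)" "Y a" for a]
    using in_arcsD1 in_arcsD2 by (subst split[OF index[OF disjI2[OF disjI1]]]) (auto simp: x_rail_def z_rail_def)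
  show ?thesis
    unfolding X Y Z using True UW by (auto simp: family_def ladder_vertices_def)
qed

lemma family_imp_profiles:
  assumes "H \<in> family r"
  shows "distance_profile H U level_u" "distance_profile H W level_w"
proof -
  note H = assms[unfolded family_iff]
  interpret pair_graph H using H by blast
  have UW: "(U, W) \<in> parcs H" "(W, U) \<in> parcs H" using H arcs_symmetric by blast+
  have le_u: "level_u x \<le> Suc (level_u y)" and le_w: "level_w x \<le> Suc (level_w y)"
    if "(x, y) \<in> parcs H" for x y
    using base_edges_levels H that by blast+
  have index: "0 < a" if "X a \<in> pverts H \<or> Y a \<in> pverts H \<or> Z a \<in> pverts H" for a
    using that H by (auto simp: ladder_vertices_def)
  have Xn: "(X a, x_rail (a - 1)) \<in> parcs H" if "X a \<in> pverts H" for a using that H by blast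
  have Zn: "(Z a, z_rail (a - 1)) \<in> parcs H" if "Z a \<in> pverts H" for a using that H by blast
  have Yn: "(Y a, x_rail (a - 1)) \<in> parcs H \<and> (Y a, z_rail (a - 1)) \<in> parcs H \<or> (Y a, Y (a - 1)) \<in> parcs H"
    if "Y a \<in> pverts H" for a using that H by blast
  have "\<exists>w. (v, w) \<in> parcs H \<and> level_u v = Suc (level_u w)" if v: "v \<in> pverts H" "v \<noteq> U" for v
  proof (cases v)
    case W
    then show ?thesis using UW by (intro exI[of _ U]) simp
  next
    case (X a)
    then show ?thesis using Xn[of a] index[of a] v by (intro exI[of _ "x_rail (a - 1)"]) simp
  next
    case (Y a)
    then have "level_u v = Suc (level_u (x_rail (a - 1)))" "level_u v = Suc (level_u (Y (a - 1)))"
      using index[of a] v by simp_all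
    moreover have "(v, x_rail (a - 1)) \<in> parcs H \<or> (v, Y (a - 1)) \<in> parcs H"
      using Yn[of a] v Y by auto
    ultimately show ?thesis by blast
  next
    case (Z a)
    then show ?thesis using Zn[of a] index[of a] v by (intro exI[of _ "z_rail (a - 1)"]) simp
  qed (use v in auto)
  then show "distance_profile H U level_u"
    using le_u in_arcsD1 UW unfolding distance_profile_def by auto
  have "\<exists>w. (v, w) \<in> parcs H \<and> level_w v = Suc (level_w w)" if v: "v \<in> pverts H" "v \<noteq> W" for v
  proof (cases v)
    case U
    then show ?thesis using UW by (intro exI[of _ W]) simp
  next
    case (X a)
    then show ?thesis using Xn[of a] index[of a] v by (intro exI[of _ "x_rail (a - 1)"]) simp
  next
    case (Y a)
    then have "level_w v = Suc (level_w (z_rail (a - 1)))" "level_w v = Suc (level_w (Y (a - 1)))"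
      using index[of a] v by simp_all
    moreover have "(v, z_rail (a - 1)) \<in> parcs H \<or> (v, Y (a - 1)) \<in> parcs H"
      using Yn[of a] v Y by auto
    ultimately show ?thesis by blast
  next
    case (Z a)
    then show ?thesis using Zn[of a] index[of a] v by (intro exI[of _ "z_rail (a - 1)"]) simp
  qed (use v in auto)
  then show "distance_profile H W level_w"
    using le_w in_arcsD1 UW unfolding distance_profile_def by auto
qed

lemma profiles_imp_family:
  assumes "pair_graph H" "(U, W) \<in> parcs H" "pverts H \<subseteq> ladder_vertices r"
    and u: "distance_profile H U level_u" and w: "distance_profile H W level_w"
  shows "H \<in> family r"
proof -
  interpret pair_graph H by fact
  have le_u: "level_u x \<le> Suc (level_u y)" and le_w: "level_w x \<le> Suc (level_w y)"
    if "(x, y) \<in> parcs H" for x y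
    using that u w unfolding distance_profile_def by blast+
  have arcs: "x \<in> ladder_vertices r" "y \<in> ladder_vertices r" "x \<noteq> y"
    "level_u x \<le> Suc (level_u y)" "level_u y \<le> Suc (level_u x)"
    "level_w x \<le> Suc (level_w y)" "level_w y \<le> Suc (level_w x)" if xy: "(x, y) \<in> parcs H" for x y
  proof -
    show "x \<in> ladder_vertices r" "y \<in> ladder_vertices r"
      using assms(3) in_arcsD1[OF xy] in_arcsD2[OF xy] by blast+
    show "x \<noteq> y" using no_loops'[OF xy] .
  qed (use xy arcs_symmetric[OF xy] in \<open>simp_all add: le_u le_w\<close>)
  have desc_u: "\<exists>y. (x, y) \<in> parcs H \<and> level_u x = Suc (level_u y)"
    if "x \<in> pverts H" "x \<noteq> U" for x
    using that u unfolding distance_profile_def by blast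
  have desc_w: "\<exists>y. (x, y) \<in> parcs H \<and> level_w x = Suc (level_w y)"
    if "x \<in> pverts H" "x \<noteq> W" for x
    using that w unfolding distance_profile_def by blast
  have "(X a, x_rail (a - 1)) \<in> parcs H" if Xa: "X a \<in> pverts H" for a
  proof -
    obtain y where y: "(X a, y) \<in> parcs H" "level_u (X a) = Suc (level_u y)"
      using desc_u[OF Xa] by blast
    then show ?thesis
      using descending_neighbours_u(1)[OF arcs(1,2,6,7)[OF y(1)] y(2) refl] by simp
  qed
  moreover have "(Z a, z_rail (a - 1)) \<in> parcs H" if Za: "Z a \<in> pverts H" for a
  proof -
    obtain y where y: "(Z a, y) \<in> parcs H" "level_w (Z a) = Suc (level_w y)"
      using desc_w[OF Za] by blast
    then show ?thesis
      using descending_neighbours_w(1)[OF arcs(1,2,4,5)[OF y(1)] y(2) refl] by simp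
  qed
  moreover have "(Y a, x_rail (a - 1)) \<in> parcs H \<and> (Y a, z_rail (a - 1)) \<in> parcs H \<or>
      (Y a, Y (a - 1)) \<in> parcs H" if Ya: "Y a \<in> pverts H" for a
  proof -
    obtain y where y: "(Y a, y) \<in> parcs H" "level_u (Y a) = Suc (level_u y)"
      using desc_u[OF Ya] by blast
    obtain z where z: "(Y a, z) \<in> parcs H" "level_w (Y a) = Suc (level_w z)"
      using desc_w[OF Ya] by blast
    show ?thesis
      using descending_neighbours_u(2)[OF arcs(1,2,6,7)[OF y(1)] y(2) refl]
        descending_neighbours_w(2)[OF arcs(1,2,4,5)[OF z(1)] z(2) refl] y(1) z(1) by auto
  qed
  moreover have "parcs H \<subseteq> base_edges r \<union> (base_edges r)\<inverse>"
    using base_edgesI[OF arcs] by auto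
  ultimately show ?thesis
    using assms(1-3) unfolding family_iff by blast
qed

text \<open>
  From a member of the family the levels are pulled back to distance profiles of \<open>G\<close>, and
  distinct names have distinct levels. Conversely, naming each vertex by its pair of distances maps
  \<open>G\<close> onto a graph whose levels are distance profiles.
\<close>

lemma in_family_iff_resolving_edge:
  assumes "pair_graph G" "Digraph_Component.connected (with_proj G)"
  shows "(\<exists>r\<ge>1. in_family G r) \<longleftrightarrow> (\<exists>(u, w)\<in>parcs G. resolving_set G {u, w})"
proof -
  interpret pair_graph G by fact
  have resolving: "resolving_set G {u, w} \<longleftrightarrow> inj_on (\<lambda>x. (\<delta> x, \<epsilon> x)) (pverts G)"
    if uw: "u \<noteq> w" "distance_profile G u \<delta>" "distance_profile G w \<epsilon>" for u w \<delta> \<epsilon>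
  proof -
    have "distance_profile G z ((if z = u then \<delta> else \<epsilon>))" if "z \<in> {u, w}" for z
      using uw that by auto
    from resolving_set_profiles[of "{u, w}", OF this] show ?thesis
      using uw(1) by (simp add: inj_on_def)
  qed
  show ?thesis
  proof
    assume "\<exists>r\<ge>1. in_family G r"
    then obtain r H where H: "H \<in> family r" "digraph_iso (with_proj G) (with_proj H)"
      unfolding in_family_def by blast
    then obtain f where f: "inj_on f (pverts G)" "H = map_graph f G"
      using digraph_iso_with_proj_iff[OF pair_wf_digraph] by blast
    note fam = H(1)[unfolded family_iff]
    then obtain u w where uw: "(u, w) \<in> parcs G" "U = f u" "W = f w"
      by (auto simp: f(2) map_graph_def)
    have V: "u \<in> pverts G" "w \<in> pverts G" using uw(1) by (auto dest: wellformed')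
    have "distance_profile G u (level_u \<circ> f)" "distance_profile G w (level_w \<circ> f)"
      using family_imp_profiles[OF H(1)] distance_profile_map_graph[OF pair_wf_digraph f(1)] V
      by (simp_all add: f(2) uw)
    moreover have "inj_on (\<lambda>x. ((level_u \<circ> f) x, (level_w \<circ> f) x)) (pverts G)"
    proof (rule inj_onI)
      fix x y assume xy: "x \<in> pverts G" "y \<in> pverts G"
        "((level_u \<circ> f) x, (level_w \<circ> f) x) = ((level_u \<circ> f) y, (level_w \<circ> f) y)"
      have "f x \<in> ladder_vertices r" "f y \<in> ladder_vertices r"
        using fam xy by (auto simp: f(2) map_graph_def)
      moreover have "level_u (f x) = level_u (f y)" "level_w (f x) = level_w (f y)"
        using xy(3) by simp_all
      ultimately have "f x = f y" by (metis at_levels_levels)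
      then show "x = y" using f(1) xy by (auto dest: inj_onD)
    qed
    ultimately have "resolving_set G {u, w}"
      using resolving no_loops'[OF uw(1)] by blast
    with uw(1) show "\<exists>(u, w)\<in>parcs G. resolving_set G {u, w}" by blast
  next
    assume "\<exists>(u, w)\<in>parcs G. resolving_set G {u, w}"
    then obtain u w where uw: "(u, w) \<in> parcs G" and res: "resolving_set G {u, w}" by blast
    have V: "u \<in> pverts G" "w \<in> pverts G" using uw by (auto dest: wellformed')
    have "u \<noteq> w" using uw by (rule no_loops')
    obtain \<delta> \<epsilon> where \<delta>: "distance_profile G u \<delta>" and \<epsilon>: "distance_profile G w \<epsilon>"
      using ex_distance_profile[OF assms(2)] V by blast
    have inj: "inj_on (\<lambda>x. (\<delta> x, \<epsilon> x)) (pverts G)"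
      using res resolving[OF \<open>u \<noteq> w\<close> \<delta> \<epsilon>] by blast
    define f where "f x = at_levels (\<delta> x) (\<epsilon> x)" for x
    have close: "\<delta> x \<le> Suc (\<epsilon> x) \<and> \<epsilon> x \<le> Suc (\<delta> x)" if x: "x \<in> pverts G" for x
      using distance_profiles_adjacent[OF pair_graph uw \<delta> \<epsilon> x] .
    have levels: "level_u (f x) = \<delta> x" "level_w (f x) = \<epsilon> x" if "x \<in> pverts G" for x
      using close[OF that] levels_at_levels by (simp_all add: f_def)
    have inj_f: "inj_on f (pverts G)"
    proof (rule inj_onI)
      fix x y assume xy: "x \<in> pverts G" "y \<in> pverts G" "f x = f y"
      then have "(\<delta> x, \<epsilon> x) = (\<delta> y, \<epsilon> y)" using levels by metis
      then show "x = y" using inj_onD[OF inj _ xy(1,2)] by simp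
    qed
    have ends: "\<delta> u = 0" "\<epsilon> w = 0" using \<delta> \<epsilon> by (auto simp: distance_profile_def)
    have "\<delta> w \<noteq> 0" "\<epsilon> u \<noteq> 0"
      using distance_profile_eq_0_iff[OF \<delta> V(2)] distance_profile_eq_0_iff[OF \<epsilon> V(1)] \<open>u \<noteq> w\<close> by auto
    then have "\<delta> w = 1" "\<epsilon> u = 1" using close[OF V(1)] close[OF V(2)] ends by auto
    then have f_ends: "f u = U" "f w = W" using ends by (simp_all add: f_def at_levels_def)
    \<comment> \<open>Any bound on all distances serves as the index range; their sum is
      such a bound, and the successor makes it positive.\<close>
    define r where "r = Suc (\<Sum>x\<in>pverts G. \<delta> x + \<epsilon> x)"
    have bound: "\<delta> x + \<epsilon> x \<le> r" if "x \<in> pverts G" for x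
      using member_le_sum[OF that, of "\<lambda>x. \<delta> x + \<epsilon> x"] pair_finite_verts by (simp add: r_def)
    have "map_graph f G \<in> family r"
    proof (rule profiles_imp_family)
      show "pair_graph (map_graph f G)" using pair_graph inj_f by (rule pair_graph_map_graph)
      show "(U, W) \<in> parcs (map_graph f G)"
        using uw f_ends by (force simp: map_graph_def)
      have "f x \<in> ladder_vertices r" if x: "x \<in> pverts G" for x
      proof -
        have "\<delta> x \<noteq> 0 \<or> \<epsilon> x \<noteq> 0"
          using distance_profile_eq_0_iff[OF \<delta> x] distance_profile_eq_0_iff[OF \<epsilon> x] \<open>u \<noteq> w\<close> by auto
        then show ?thesis
          using bound[OF x] by (auto simp: f_def at_levels_def ladder_vertices_def)
      qed
      then show "pverts (map_graph f G) \<subseteq> ladder_vertices r" by (auto simp: map_graph_def)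
      have "distance_profile G u (level_u \<circ> f)"
        using \<delta> distance_profile_cong[OF pair_wf_digraph, of "level_u \<circ> f" \<delta>] levels by simp
      then show "distance_profile (map_graph f G) U level_u"
        using distance_profile_map_graph[OF pair_wf_digraph inj_f V(1)] f_ends by simp
      have "distance_profile G w (level_w \<circ> f)"
        using \<epsilon> distance_profile_cong[OF pair_wf_digraph, of "level_w \<circ> f" \<epsilon>] levels by simp
      then show "distance_profile (map_graph f G) W level_w"
        using distance_profile_map_graph[OF pair_wf_digraph inj_f V(2)] f_ends by simp
    qed
    then have "in_family G r"
      unfolding in_family_def using digraph_iso_with_proj_iff[OF pair_wf_digraph] inj_f by blast
    then show "\<exists>r\<ge>1. in_family G r" by (auto simp: r_def)
  qed
qed

section \<open>Planar drawings by nested triangles\<close>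

text \<open>
  Certifies a straight-line drawing by a function \<open>cell\<close> that reconstructs from a point of the
  plane the vertex at this point or the ends of the edge through it. Such a function excludes all
  crossings at once, without a comparison of pairs of edges.
\<close>

lemma planar_if_cell:
  fixes pos :: "'a \<Rightarrow> real \<times> real" and cell :: "real \<times> real \<Rightarrow> 'a set"
  assumes "pair_loopfree_digraph G"
    and vertex: "\<And>v. v \<in> pverts G \<Longrightarrow> cell (pos v) = {v}"
    and edge: "\<And>x y t. (x, y) \<in> parcs G \<Longrightarrow> 0 < t \<Longrightarrow> t < 1 \<Longrightarrow>
      cell ((1 - t) *\<^sub>R pos x + t *\<^sub>R pos y) = {x, y}"
  shows "planar G"
proof -
  interpret pair_loopfree_digraph G by fact
  \<comment> \<open>An edge is given as an unordered pair, so one of its two orientations has to be chosen.\<close>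
  define crv where "crv e = (case SOME (a, b). e = {a, b} of (a, b) \<Rightarrow> linepath (pos a) (pos b))" for e
  have crv: "crv {x, y} = linepath (pos x) (pos y) \<or> crv {x, y} = linepath (pos y) (pos x)" for x y
  proof -
    have "case SOME (a, b). {x, y} = {a, b} of (a, b) \<Rightarrow> {x, y} = {a, b}"
      by (rule someI[of "\<lambda>(a, b). {x, y} = {a, b}" "(x, y)"]) simp
    then show ?thesis by (auto simp: crv_def doubleton_eq_iff split: prod.splits)
  qed
  have image: "path_image (crv {x, y}) = closed_segment (pos x) (pos y)" for x y
    using crv[of x y] by (auto simp: closed_segment_commute)
  have inj: "inj_on pos (pverts G)"
    by (rule inj_onI) (metis vertex singleton_inject)
  have point: "z = pos x \<or> z = pos y \<or> cell z = {x, y}"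
    if z: "z \<in> path_image (crv {x, y})" and xy: "(x, y) \<in> parcs G" for x y z
  proof -
    obtain t where "0 \<le> t" "t \<le> 1" "z = (1 - t) *\<^sub>R pos x + t *\<^sub>R pos y"
      using z by (auto simp: image in_segment)
    then show ?thesis using edge[OF xy, of t] by (cases "t = 0"; cases "t = 1") auto
  qed
  have "planar_drawing G pos crv"
    unfolding planar_drawing_def
  proof (intro conjI inj ballI; clarify)
    fix x y assume xy: "(x, y) \<in> parcs G"
    then have V: "x \<in> pverts G" "y \<in> pverts G" and ne: "x \<noteq> y"
      using wellformed' no_loops' by blast+
    then have "pos x \<noteq> pos y" using inj by (auto dest: inj_onD)
    then show "Path_Connected.arc (crv {x, y}) \<and>
        {pathstart (crv {x, y}), pathfinish (crv {x, y})} = {pos x, pos y} \<and>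
        path_image (crv {x, y}) \<inter> pos ` pverts G = {pos x, pos y}"
    proof (intro conjI)
      show "Path_Connected.arc (crv {x, y})"
        using crv[of x y] \<open>pos x \<noteq> pos y\<close> by (auto intro: arc_linepath)
      show "{pathstart (crv {x, y}), pathfinish (crv {x, y})} = {pos x, pos y}"
        using crv[of x y] by auto
      have "pos v \<in> {pos x, pos y}" if "pos v \<in> path_image (crv {x, y})" "v \<in> pverts G" for v
        using point[OF that(1) xy] vertex[OF that(2)] ne by auto
      then have "path_image (crv {x, y}) \<inter> pos ` pverts G \<subseteq> {pos x, pos y}" by blast
      then show "path_image (crv {x, y}) \<inter> pos ` pverts G = {pos x, pos y}"
        using V by (simp add: image subset_antisym)
    qed
  next
    fix x y x' y' z
    assume xy: "(x, y) \<in> parcs G" "(x', y') \<in> parcs G" and ne: "{x, y} \<noteq> {x', y'}"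
      and z: "z \<in> path_image (crv {x, y})" "z \<in> path_image (crv {x', y'})"
    have V: "{x, y, x', y'} \<subseteq> pverts G" "x \<noteq> y" "x' \<noteq> y'"
      using xy wellformed' no_loops' by blast+
    then have "cell (pos x) = {x}" "cell (pos y) = {y}"
      "cell (pos x') = {x'}" "cell (pos y') = {y'}"
      using vertex by auto
    note ends = this
    have "z = pos x \<or> z = pos y" "z = pos x' \<or> z = pos y'"
      using point[OF z(1) xy(1)] point[OF z(2) xy(2)] ends V(2,3) ne by auto
    then obtain v v' where v: "v \<in> {x, y}" "v' \<in> {x', y'}" "z = pos v" "z = pos v'" by blast
    then have "{v} = {v'}" using ends by auto
    with v show "z \<in> pos ` ({x, y} \<inter> {x', y'})" by simp
  qed
  then show ?thesis unfolding planar_def by blast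
qed

text \<open>
  The triangle with the directions \<open>(1, 0)\<close>, \<open>(0, 1)\<close>, \<open>(-1, -1)\<close> as corners
  contains the origin, and its copy scaled by \<open>a + 1\<close> carries the three vertices of index
  \<open>a\<close>.
\<close>

primrec position :: "fvertex \<Rightarrow> real \<times> real" where
  "position U = (1, 0)"
| "position W = (-1, -1)"
| "position (X a) = (real a + 1, 0)"
| "position (Y a) = (0, real a + 1)"
| "position (Z a) = (- (real a + 1), - (real a + 1))"

text \<open>
  The Minkowski functional of that triangle: the factor by which it must be scaled for its boundary
  to pass through the given point. On each of the three sectors it is the linear function that takes
  the value \<open>1\<close> at both adjacent corners.
\<close>

definition triangle_gauge :: "real \<times> real \<Rightarrow> real" where
  "triangle_gauge = (\<lambda>(x, y). max (x + y) (max (y - 2 * x) (x - 2 * y)))"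

text \<open>
  A point lies on one of the three rays or in one of the sectors between them. This tells the types
  of the two ends of an edge through it, and rounding the gauge tells their indices. The edges that
  join different indices in a sector run from the inner rail vertex to the outer \<open>Y\<close>, which is
  why \<open>Y\<close> gets the index that is rounded up. For a vertex the two ends coincide.
\<close>

definition cell :: "real \<times> real \<Rightarrow> fvertex set" where
  "cell = (\<lambda>(x, y).
     let k = nat \<lfloor>triangle_gauge (x, y) - 1\<rfloor>; l = nat \<lceil>triangle_gauge (x, y) - 1\<rceil> in
     if y = 0 \<and> 0 < x then {x_rail k, x_rail l}
     else if x = 0 \<and> 0 < y then {Y k, Y l}
     else if x = y \<and> x < 0 then {z_rail k, z_rail l}
     else if 0 < x \<and> 0 < y then {x_rail k, Y l}
     else if x < 0 \<and> x < y then {z_rail k, Y l}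
     else {x_rail k, z_rail l})"

lemma triangle_gauge_simps:
  "0 < x \<Longrightarrow> triangle_gauge (x, 0) = x" "0 < x \<Longrightarrow> triangle_gauge (0, x) = x" "0 < x \<Longrightarrow> triangle_gauge (- x, - x) = x"
  "0 < x \<Longrightarrow> 0 < y \<Longrightarrow> triangle_gauge (x, y) = x + y"
  "0 < x \<Longrightarrow> 0 < y \<Longrightarrow> triangle_gauge (- x, y - x) = x + y"
  "0 < x \<Longrightarrow> 0 < y \<Longrightarrow> triangle_gauge (x - y, - y) = x + y"
  by (simp_all add: triangle_gauge_def)

text \<open>
  The points of the six regions are written as combinations of the corner directions with positive
  coefficients, so that the gauge is the sum of the coefficients.
\<close>

lemma cell_simps:
  "0 < x \<Longrightarrow> cell (x, 0) = {x_rail (nat \<lfloor>x - 1\<rfloor>), x_rail (nat \<lceil>x - 1\<rceil>)}"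
  "0 < x \<Longrightarrow> cell (0, x) = {Y (nat \<lfloor>x - 1\<rfloor>), Y (nat \<lceil>x - 1\<rceil>)}"
  "0 < x \<Longrightarrow> cell (- x, - x) = {z_rail (nat \<lfloor>x - 1\<rfloor>), z_rail (nat \<lceil>x - 1\<rceil>)}"
  "0 < x \<Longrightarrow> 0 < y \<Longrightarrow>
    cell (x, y) = {x_rail (nat \<lfloor>x + y - 1\<rfloor>), Y (nat \<lceil>x + y - 1\<rceil>)}"
  "0 < x \<Longrightarrow> 0 < y \<Longrightarrow>
    cell (- x, y - x) = {z_rail (nat \<lfloor>x + y - 1\<rfloor>), Y (nat \<lceil>x + y - 1\<rceil>)}"
  "0 < x \<Longrightarrow> 0 < y \<Longrightarrow>
    cell (x - y, - y) = {x_rail (nat \<lfloor>x + y - 1\<rfloor>), z_rail (nat \<lceil>x + y - 1\<rceil>)}"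
  by (simp_all add: cell_def triangle_gauge_simps Let_def)

lemma floor_ceiling_between:
  fixes t :: real
  assumes "0 < t" "t < 1"
  shows "nat \<lfloor>real a + t\<rfloor> = a" "nat \<lceil>real a + t\<rceil> = Suc a"
proof -
  have "\<lfloor>real a + t\<rfloor> = int a" using assms by (intro floor_unique) auto
  moreover have "\<lceil>real a + t\<rceil> = int a + 1" using assms by (intro ceiling_unique) auto
  ultimately show "nat \<lfloor>real a + t\<rfloor> = a" "nat \<lceil>real a + t\<rceil> = Suc a" by simp_all
qed

lemma cell_on_rays:
  assumes "0 < t" "t < 1"
  shows "cell (real a + 1 + t, 0) = {x_rail a, x_rail (Suc a)}"
    "cell (0, real a + 1 + t) = {Y a, Y (Suc a)}"
    "cell (- (real a + 1 + t), - (real a + 1 + t)) = {z_rail a, z_rail (Suc a)}"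
proof -
  have "real a + 1 + t - 1 = real a + t" by simp
  then show "cell (real a + 1 + t, 0) = {x_rail a, x_rail (Suc a)}"
    "cell (0, real a + 1 + t) = {Y a, Y (Suc a)}"
    "cell (- (real a + 1 + t), - (real a + 1 + t)) = {z_rail a, z_rail (Suc a)}"
    using assms floor_ceiling_between[OF assms, of a] cell_simps(1-3)[of "real a + 1 + t"]
    by (simp_all only: of_nat_0_le_iff add_nonneg_pos)
qed

lemma cell_position:
  assumes "v \<noteq> X 0" "v \<noteq> Z 0"
  shows "cell (position v) = {v}"
proof (cases v)
  case U
  then show ?thesis using cell_simps(1)[of 1] by (simp add: x_rail_def)
next
  case W
  then show ?thesis using cell_simps(3)[of 1] by (simp add: z_rail_def)
next
  case (X a)
  then show ?thesis using cell_simps(1)[of "real a + 1"] assms by (simp add: x_rail_def)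
next
  case (Y a)
  then show ?thesis using cell_simps(2)[of "real a + 1"] assms by simp
next
  case (Z a)
  then show ?thesis using cell_simps(3)[of "real a + 1"] assms by (simp add: z_rail_def)
qed

lemma position_x_rail: "position (x_rail a) = (real a + 1, 0)"
  and position_z_rail: "position (z_rail a) = (- (real a + 1), - (real a + 1))"
  by (auto simp: x_rail_def z_rail_def)

text \<open>
  The edge types of the family in terms of the rails, directed so that the index does not decrease.
\<close>

inductive_set layered_edges :: "fvertex rel" where
  "(x_rail a, x_rail (Suc a)) \<in> layered_edges"
| "(Y a, Y (Suc a)) \<in> layered_edges"
| "(z_rail a, z_rail (Suc a)) \<in> layered_edges"
| "(x_rail a, Y (Suc a)) \<in> layered_edges"
| "(z_rail a, Y (Suc a)) \<in> layered_edges"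
| "(x_rail a, Y a) \<in> layered_edges"
| "(z_rail a, Y a) \<in> layered_edges"
| "(x_rail a, z_rail a) \<in> layered_edges"

lemma base_edges_subset: "base_edges r \<subseteq> layered_edges \<union> layered_edges\<inverse>"
proof -
  have *: "\<exists>b. a = Suc (Suc b)" if "a \<in> {2..r}" for a
    using that by (auto intro: exI[of _ "a - 2"])
  have "(X a, Y a) \<in> layered_edges" "(X a, Z a) \<in> layered_edges" "(Z a, Y a) \<in> layered_edges"
    if "Suc 0 \<le> a" for a
    using that layered_edges.intros(6-8)[of a] by (auto simp: x_rail_def z_rail_def)
  note ring = this
  note i = layered_edges.intros[of 0] layered_edges.intros[of "Suc b" for b]
  note i' = i[unfolded x_rail_def z_rail_def, simplified]
  show ?thesis unfolding base_edges_def by (auto dest!: * intro: i' ring)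
qed

text \<open>
  An edge stays in one ray or sector, on which the gauge is linear. Along the edge it interpolates
  between the values \<open>a + 1\<close> and \<open>a + 1\<close> or \<open>a + 2\<close> at the ends, so rounding and
  subtracting one recovers the two indices.
\<close>

lemma cell_layered_edge:
  assumes "(v, w) \<in> layered_edges" "0 < t" "t < 1"
  shows "cell ((1 - t) *\<^sub>R position v + t *\<^sub>R position w) = {v, w}"
  using assms(1)
proof cases
  case (1 a)
  then show ?thesis using cell_on_rays(1)[OF assms(2,3), of a]
    by (simp add: position_x_rail algebra_simps)
next
  case (2 a)
  then show ?thesis using cell_on_rays(2)[OF assms(2,3), of a]
    by (simp add: algebra_simps)
next
  case (3 a)
  then have "(1 - t) *\<^sub>R position v + t *\<^sub>R position w =
      (- (real a + 1 + t), - (real a + 1 + t))"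
    by (simp add: position_z_rail algebra_simps)
  then show ?thesis using 3 cell_on_rays(3)[OF assms(2,3), of a] by simp
next
  case (4 a)
  have "(1 - t) * (real a + 1) + t * (real a + 2) - 1 = real a + t" by (simp add: algebra_simps)
  then show ?thesis using 4 assms(2,3) floor_ceiling_between[OF assms(2,3), of a]
      cell_simps(4)[of "(1 - t) * (real a + 1)" "t * (real a + 2)"]
    by (simp add: position_x_rail add_ac)
next
  case (5 a)
  have "(1 - t) * (real a + 1) + t * (real a + 2) - 1 = real a + t" by (simp add: algebra_simps)
  moreover have "(1 - t) *\<^sub>R position v + t *\<^sub>R position w =
      (- ((1 - t) * (real a + 1)), t * (real a + 2) - (1 - t) * (real a + 1))"
    using 5 by (simp add: position_z_rail algebra_simps)
  ultimately show ?thesis using 5 assms(2,3) floor_ceiling_between[OF assms(2,3), of a]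
      cell_simps(5)[of "(1 - t) * (real a + 1)" "t * (real a + 2)"]
    by (simp add: position_z_rail add_ac)
next
  case (6 a)
  have "(1 - t) * (real a + 1) + t * (real a + 1) - 1 = real a" by (simp add: algebra_simps)
  then show ?thesis using 6 assms(2,3)
      cell_simps(4)[of "(1 - t) * (real a + 1)" "t * (real a + 1)"]
    by (simp add: position_x_rail)
next
  case (7 a)
  have "(1 - t) * (real a + 1) + t * (real a + 1) - 1 = real a" by (simp add: algebra_simps)
  moreover have "(1 - t) *\<^sub>R position v + t *\<^sub>R position w =
      (- ((1 - t) * (real a + 1)), t * (real a + 1) - (1 - t) * (real a + 1))"
    using 7 by (simp add: position_z_rail algebra_simps)
  ultimately show ?thesis using 7 assms(2,3)
      cell_simps(5)[of "(1 - t) * (real a + 1)" "t * (real a + 1)"]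
    by simp
next
  case (8 a)
  have "(1 - t) * (real a + 1) + t * (real a + 1) - 1 = real a" by (simp add: algebra_simps)
  moreover have "(1 - t) *\<^sub>R position v + t *\<^sub>R position w =
      ((1 - t) * (real a + 1) - t * (real a + 1), - (t * (real a + 1)))"
    using 8 by (simp add: position_x_rail position_z_rail algebra_simps)
  ultimately show ?thesis using 8 assms(2,3)
      cell_simps(6)[of "(1 - t) * (real a + 1)" "t * (real a + 1)"]
    by simp
qed

lemma cell_base_edge:
  assumes "(v, w) \<in> base_edges r \<union> (base_edges r)\<inverse>" "0 < t" "t < 1"
  shows "cell ((1 - t) *\<^sub>R position v + t *\<^sub>R position w) = {v, w}"
proof -
  have "(v, w) \<in> layered_edges \<or> (w, v) \<in> layered_edges"
    using assms(1) base_edges_subset by blast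
  then show ?thesis
    using cell_layered_edge[of v w t] cell_layered_edge[of w v "1 - t"] assms(2,3)
    by (auto simp: add.commute insert_commute)
qed

text \<open>
  The drawing of a member of the family is pulled back along the isomorphism.
\<close>

lemma in_family_imp_planar:
  assumes "pair_graph G" "in_family G r"
  shows "planar G"
proof -
  interpret pair_graph G by fact
  obtain H where H: "H \<in> family r" "digraph_iso (with_proj G) (with_proj H)"
    using assms(2) unfolding in_family_def by blast
  then obtain f where f: "inj_on f (pverts G)" "map_graph f G \<in> family r"
    using digraph_iso_with_proj_iff[OF pair_wf_digraph, of H] by auto
  then have V: "f x \<in> ladder_vertices r" if "x \<in> pverts G" for x
    using that by (auto simp: family_iff map_graph_def)
  have E: "(f x, f y) \<in> base_edges r \<union> (base_edges r)\<inverse>" if "(x, y) \<in> parcs G" for x y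
    using that f(2) by (auto simp: family_iff map_graph_def)
  have pull: "{v \<in> pverts G. f v \<in> f ` A} = A" if "A \<subseteq> pverts G" for A
    using that f(1) by (auto dest: inj_onD)
  show ?thesis
  proof (rule planar_if_cell)
    show "pair_loopfree_digraph G" by unfold_locales
    show "{v \<in> pverts G. f v \<in> cell ((position \<circ> f) x)} = {x}" if x: "x \<in> pverts G" for x
    proof -
      have "f x \<noteq> X 0" "f x \<noteq> Z 0" using V[OF x] by (auto simp: ladder_vertices_def)
      then have "cell ((position \<circ> f) x) = f ` {x}" by (simp add: cell_position)
      then show ?thesis using pull[of "{x}"] x by simp
    qed
    show "{v \<in> pverts G. f v \<in> cell ((1 - t) *\<^sub>R (position \<circ> f) x + t *\<^sub>R (position \<circ> f) y)} = {x, y}"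
      if xy: "(x, y) \<in> parcs G" and t: "0 < t" "t < 1" for x y t
    proof -
      have "cell ((1 - t) *\<^sub>R (position \<circ> f) x + t *\<^sub>R (position \<circ> f) y) = f ` {x, y}"
        using cell_base_edge[OF E[OF xy] t] by simp
      then show ?thesis using pull[of "{x, y}"] xy by (auto dest: wellformed')
    qed
  qed
qed

section \<open>Connected resolving sets of two vertices\<close>

lemma connected_induced_singleton:
  "Digraph_Component.connected (with_proj G \<restriction> {s})"
  by (auto simp: connected_conv)

lemma (in pair_graph) connected_induced_pair_iff:
  assumes "u \<noteq> w"
  shows "Digraph_Component.connected (with_proj G \<restriction> {u, w}) \<longleftrightarrow> (u, w) \<in> parcs G"
proof -
  let ?R = "(arcs_ends (with_proj G \<restriction> {u, w}))\<^sup>s"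
  have R: "(x, y) \<in> ?R \<longleftrightarrow> (x, y) \<in> parcs G \<and> x \<in> {u, w} \<and> y \<in> {u, w}" for x y
    using arcs_symmetric by (auto simp: arcs_ends_conv symcl_def)
  show ?thesis
  proof
    assume "Digraph_Component.connected (with_proj G \<restriction> {u, w})"
    then have "(u, w) \<in> ?R\<^sup>*"
      by (auto simp: connected_conv dest!: rtrancl_on_rtranclI)
    then obtain y where "(u, y) \<in> ?R" using assms by (meson converse_rtranclE)
    then have "(u, y) \<in> parcs G" "y \<in> {u, w}" by (simp_all only: R)
    then show "(u, w) \<in> parcs G" using no_loops' by auto
  next
    assume uw: "(u, w) \<in> parcs G"
    then have "(x, y) \<in> rtrancl_on {u, w} ?R" if "x \<in> {u, w}" "y \<in> {u, w}" for x y
    proof (cases "x = y")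
      case False
      then have "(x, y) \<in> parcs G" using that uw arcs_symmetric by auto
      then have "(x, y) \<in> ?R" using that by (simp only: R)
      then show ?thesis using that
        by (meson rtrancl_on_refl rtrancl_on_into_rtrancl_on)
    qed (use that in auto)
    then show "Digraph_Component.connected (with_proj G \<restriction> {u, w})"
      by (simp add: connected_conv)
  qed
qed

text \<open>
  Sets of size zero are not connected, those of size one always are, and two vertices are connected
  when they are adjacent. The set of all vertices is a connected resolving set, since a vertex is the
  only one at distance \<open>0\<close> from itself; hence the minimum is attained.
\<close>

lemma cdim_eq_2_iff:
  assumes "pair_graph G" "Digraph_Component.connected (with_proj G)"
  shows "cdim G = 2 \<longleftrightarrow>
    (\<forall>z. \<not> resolving_set G {z}) \<and> (\<exists>(u, w)\<in>parcs G. resolving_set G {u, w})"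
proof -
  interpret pair_graph G by fact
  let ?P = "\<lambda>k. \<exists>S. connected_resolving_set G S \<and> card S = k"
  have fin: "finite S" if "connected_resolving_set G S" for S
    using that pair_finite_verts
    by (auto simp: connected_resolving_set_def resolving_set_def intro: finite_subset)
  have "\<not> connected_resolving_set G {}"
    by (simp add: connected_resolving_set_def connected_conv)
  then have P0: "\<not> ?P 0" using fin by (metis card_0_eq)
  have P1: "?P 1 \<longleftrightarrow> (\<exists>z. resolving_set G {z})"
    using connected_induced_singleton[of G]
    by (force simp: connected_resolving_set_def card_1_singleton_iff)
  have P2: "?P 2 \<longleftrightarrow> (\<exists>(u, w)\<in>parcs G. resolving_set G {u, w})"
  proof
    assume "?P 2"
    then obtain u w where "u \<noteq> w" "connected_resolving_set G {u, w}"
      by (metis card_2_iff)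
    then show "\<exists>(u, w)\<in>parcs G. resolving_set G {u, w}"
      using connected_induced_pair_iff by (auto simp: connected_resolving_set_def)
  next
    assume "\<exists>(u, w)\<in>parcs G. resolving_set G {u, w}"
    then obtain u w where uw: "(u, w) \<in> parcs G" "resolving_set G {u, w}" by blast
    then have "u \<noteq> w" using no_loops' by blast
    then have "connected_resolving_set G {u, w}" "card {u, w} = 2"
      using uw connected_induced_pair_iff by (auto simp: connected_resolving_set_def)
    then show "?P 2" by blast
  qed
  have ex: "\<exists>k. ?P k"
  proof -
    obtain \<delta> where \<delta>: "\<And>z. z \<in> pverts G \<Longrightarrow> distance_profile G z (\<delta> z)"
      using ex_distance_profile[OF assms(2)] by metis
    have "x = y" if "x \<in> pverts G" "y \<in> pverts G" "\<forall>z\<in>pverts G. \<delta> z x = \<delta> z y" for x y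
      using that distance_profile_eq_0_iff[OF \<delta>] by metis
    then have "resolving_set G (pverts G)" using resolving_set_profiles[OF \<delta>] by blast
    moreover have "with_proj G \<restriction> pverts G = with_proj G"
      by (rule pre_digraph.equality) (auto dest: wellformed')
    ultimately have "connected_resolving_set G (pverts G)"
      using assms(2) by (simp add: connected_resolving_set_def)
    then show ?thesis by blast
  qed
  have "cdim G = 2 \<longleftrightarrow> \<not> ?P 1 \<and> ?P 2"
  proof
    assume "cdim G = 2"
    then show "\<not> ?P 1 \<and> ?P 2"
      using LeastI_ex[OF ex] not_less_Least[of 1 ?P] unfolding cdim_def by auto
  next
    assume P12: "\<not> ?P 1 \<and> ?P 2"
    then have "2 \<le> k" if "?P k" for k
      using that P0 by (metis One_nat_def less_2_cases not_less)
    with P12 show "cdim G = 2" unfolding cdim_def by (intro Least_equality) auto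
  qed
  then show ?thesis unfolding P1 P2 by blast
qed

theorem corollary4p3:
  fixes G :: "'a pair_pre_digraph" and n :: nat
  assumes "pair_graph G"
    and "Digraph_Component.connected (with_proj G)"
    and "card (pverts G) = n" and "n \<ge> 3"
  shows "(cdim G = 2 \<longleftrightarrow> \<not> is_path_graph G \<and> (\<exists>r\<ge>1. in_family G r)) \<and>
    (cdim G = 2 \<longrightarrow> planar G)"
proof -
  have "cdim G = 2 \<longleftrightarrow> \<not> is_path_graph G \<and> (\<exists>r\<ge>1. in_family G r)"
    using cdim_eq_2_iff is_path_graph_iff_resolving_singleton in_family_iff_resolving_edge
      assms(1,2) by metis
  then show ?thesis using in_family_imp_planar[OF assms(1)] by blast
qed

end
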